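(* Let $\hat a_x,\hat a_z\in\mathcal{F}$. If $x$ and $z$ do not share a common subprefix (for words of length at least one: if they do not begin with the same letter), then $K(\hat a_z,\hat a_x)=0$.
   Context: Let $r,s\in(0,1)$, $P=\begin{pmatrix}P_{0,0}&P_{0,1}\\P_{1,0}&P_{1,1}\end{pmatrix}=\begin{pmatrix}r&1-r\\1-s&s\end{pmatrix}$, and let $\pi=(\pi_0,\pi_1)$ be the probability vector with $\pi P=\pi$. On $\{0,1\}^{\mathbb N}$ let $\mu$ be the Markov probability $\mu[x_1,\dots,x_n]=\pi_{x_1}P_{x_1,x_2}\cdots P_{x_{n-1},x_n}$. The Ruelle operator is $\mathscr{L}_{\log J}\varphi(x_1,x_2,\dots)=\sum_{i=0,1}\frac{\pi_iP_{i,x_1}}{\pi_{x_1}}\varphi(i,x_1,x_2,\dots)$. For a finite word $x=(x_1,\dots,x_n)$, $n\ge1$, $[x]$ is its cylinder and $$e_{[x]}=\tfrac{1}{\sqrt{\mu([x])}}\Big(\sqrt{\tfrac{P_{x_n,1}}{P_{x_n,0}}}\,1_{[x0]}-\sqrt{\tfrac{P_{x_n,0}}{P_{x_n,1}}}\,1_{[x1]}\Big),\quad a_x=\sqrt{\tfrac{\pi_{x_1}}{\pi_0P_{0,x_1}}}\,e_{[0x]}-\sqrt{\tfrac{\pi_{x_1}}{\pi_1P_{1,x_1}}}\,e_{[1x]},\quad \hat a_x=\frac{a_x}{|a_x|},$$ with $|\cdot|$ the $L^2(\mu)$ norm. Also $V_1=\pi_1P_{1,0}1_{[00]}-\pi_0P_{0,0}1_{[10]}$,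 $V_2=\pi_0P_{0,1}1_{[11]}-\pi_1P_{1,1}1_{[01]}$, $\hat a_\emptyset^0=V_1/|V_1|$, $\hat a_\emptyset^1=V_2/|V_2|$. $\mathcal{F}$ is the family of all $\hat a_x$ ($x$ a finite word of length $\ge1$) together with $\hat a_\emptyset^0,\hat a_\emptyset^1$ (attached to two versions $\emptyset^0,\emptyset^1$ of the empty word, of length $0$); a generic element of $\mathcal{F}$ is written $\hat a_x$. $\mathcal{F}$ is an orthonormal basis of the kernel of $\mathscr{L}_{\log J}$. $z$ is a subprefix of $x$ if $z=(x_1,\dots,x_k)$, $x=(x_1,\dots,x_n)$, $n\ge k\ge1$. By convention $\emptyset^i$ is a subprefix of itself and of exactly the words of length $\ge1$ with first letter $i$. $K$ denotes the sectional curvature, at $\mu$, of the Riemannian manifold $\mathcal{N}$ of Hölder equilibrium probabilities on $\{0,1\}^{\mathbb N}$ (tangent space at $\mu$: kernel of $\mathscr{L}_{\log J}$; metric $\langle X,Y\rangle=\int XY\,d\mu$). For distinct $X,Y\in\mathcal F$ it is expressed through the orthonormal basis $\mathcal F$ by $K(X,Y)=\frac14\big[\sum_{Z\in\mathcal F}(\int XYZ\,d\mu)^2-\sum_{Z\in\mathcal F}\int X^2Z\,d\mu\int Y^2Z\,d\mu\big]$, and this expression is what is meant by $K$ here. *)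

theory Defs
  imports "HOL-Probability.Probability" "HOL-Library.Sublist" "HOL-Library.Z2"
begin

text \<open>
  The alphabet \<open>{0, 1}\<close> is the two-element type \<^typ>\<open>bit\<close>, used only for its constants \<open>0\<close>
  and \<open>1\<close>.  A point of the shift space is \<open>\<omega> :: nat \<Rightarrow> bit\<close>, whose first letter is \<open>\<omega> 0\<close>.
\<close>

definition transition :: "real \<Rightarrow> real \<Rightarrow> bit \<Rightarrow> bit \<Rightarrow> real" where
  "transition r s i j =
     (if i = 0 then (if j = 0 then r else 1 - r) else (if j = 0 then 1 - s else s))"

definition stationary_vector :: "(bit \<Rightarrow> bit \<Rightarrow> real) \<Rightarrow> (bit \<Rightarrow> real) \<Rightarrow> bool" where
  "stationary_vector P \<pi> \<longleftrightarrow>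
     0 \<le> \<pi> 0 \<and> 0 \<le> \<pi> 1 \<and> \<pi> 0 + \<pi> 1 = 1 \<and> (\<forall>j. \<pi> 0 * P 0 j + \<pi> 1 * P 1 j = \<pi> j)"

definition cylinder :: "bit list \<Rightarrow> (nat \<Rightarrow> bit) set" where
  "cylinder w = {\<omega>. \<forall>i<length w. \<omega> i = w ! i}"

text \<open>
  For a stochastic matrix and a stationary vector there is exactly one such measure, since the
  cylinders form a generator of the product sigma-algebra that is closed under intersection.
\<close>

definition markov_measure ::
  "(bit \<Rightarrow> bit \<Rightarrow> real) \<Rightarrow> (bit \<Rightarrow> real) \<Rightarrow> (nat \<Rightarrow> bit) measure \<Rightarrow> bool" where
  "markov_measure P \<pi> \<mu> \<longleftrightarrow>
     prob_space \<mu> \<and>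
     sets \<mu> = sets (PiM UNIV (\<lambda>_. count_space UNIV)) \<and>
     (\<forall>w. w \<noteq> [] \<longrightarrow>
        measure \<mu> (cylinder w) = \<pi> (hd w) * (\<Prod>i<length w - 1. P (w ! i) (w ! Suc i)))"

definition L2_norm :: "'a measure \<Rightarrow> ('a \<Rightarrow> real) \<Rightarrow> real" where
  "L2_norm \<mu> f = sqrt (\<integral>\<omega>. (f \<omega>)\<^sup>2 \<partial>\<mu>)"

definition normalized :: "'a measure \<Rightarrow> ('a \<Rightarrow> real) \<Rightarrow> 'a \<Rightarrow> real" where
  "normalized \<mu> f = (\<lambda>\<omega>. f \<omega> / L2_norm \<mu> f)"

text \<open>In the next two definitions the word is meant to be nonempty.\<close>

definition e_fun ::
  "(bit \<Rightarrow> bit \<Rightarrow> real) \<Rightarrow> (nat \<Rightarrow> bit) measure \<Rightarrow> bit list \<Rightarrow> (nat \<Rightarrow> bit) \<Rightarrow> real" where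
  "e_fun P \<mu> x = (\<lambda>\<omega>. 1 / sqrt (measure \<mu> (cylinder x)) *
     (sqrt (P (last x) 1 / P (last x) 0) * indicator (cylinder (x @ [0])) \<omega>
      - sqrt (P (last x) 0 / P (last x) 1) * indicator (cylinder (x @ [1])) \<omega>))"

definition a_fun ::
  "(bit \<Rightarrow> bit \<Rightarrow> real) \<Rightarrow> (bit \<Rightarrow> real) \<Rightarrow> (nat \<Rightarrow> bit) measure \<Rightarrow>
   bit list \<Rightarrow> (nat \<Rightarrow> bit) \<Rightarrow> real" where
  "a_fun P \<pi> \<mu> x = (\<lambda>\<omega>.
     sqrt (\<pi> (hd x) / (\<pi> 0 * P 0 (hd x))) * e_fun P \<mu> (0 # x) \<omega>
     - sqrt (\<pi> (hd x) / (\<pi> 1 * P 1 (hd x))) * e_fun P \<mu> (1 # x) \<omega>)"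

definition V1 :: "(bit \<Rightarrow> bit \<Rightarrow> real) \<Rightarrow> (bit \<Rightarrow> real) \<Rightarrow> (nat \<Rightarrow> bit) \<Rightarrow> real" where
  "V1 P \<pi> = (\<lambda>\<omega>. \<pi> 1 * P 1 0 * indicator (cylinder [0, 0]) \<omega>
                 - \<pi> 0 * P 0 0 * indicator (cylinder [1, 0]) \<omega>)"

definition V2 :: "(bit \<Rightarrow> bit \<Rightarrow> real) \<Rightarrow> (bit \<Rightarrow> real) \<Rightarrow> (nat \<Rightarrow> bit) \<Rightarrow> real" where
  "V2 P \<pi> = (\<lambda>\<omega>. \<pi> 0 * P 0 1 * indicator (cylinder [1, 1]) \<omega>
                 - \<pi> 1 * P 1 1 * indicator (cylinder [0, 1]) \<omega>)"

text \<open>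
  Indices of the family: \<open>Empty i\<close> is the \<open>i\<close>-th version of the empty word, and \<open>Word x\<close> is an
  honest word, which has to be nonempty to be an index (see \<open>indices\<close>).
\<close>

datatype index = Empty bit | Word "bit list"

definition indices :: "index set" where
  "indices = range Empty \<union> {Word x | x. x \<noteq> []}"

fun a_hat ::
  "(bit \<Rightarrow> bit \<Rightarrow> real) \<Rightarrow> (bit \<Rightarrow> real) \<Rightarrow> (nat \<Rightarrow> bit) measure \<Rightarrow>
   index \<Rightarrow> (nat \<Rightarrow> bit) \<Rightarrow> real" where
  "a_hat P \<pi> \<mu> (Empty i) = normalized \<mu> (if i = 0 then V1 P \<pi> else V2 P \<pi>)"
| "a_hat P \<pi> \<mu> (Word x) = normalized \<mu> (a_fun P \<pi> \<mu> x)"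

definition basis_family ::
  "(bit \<Rightarrow> bit \<Rightarrow> real) \<Rightarrow> (bit \<Rightarrow> real) \<Rightarrow> (nat \<Rightarrow> bit) measure \<Rightarrow>
   ((nat \<Rightarrow> bit) \<Rightarrow> real) set" where
  "basis_family P \<pi> \<mu> = a_hat P \<pi> \<mu> ` indices"

fun subprefix :: "index \<Rightarrow> index \<Rightarrow> bool" where
  "subprefix (Empty i) (Empty j) \<longleftrightarrow> i = j"
| "subprefix (Empty i) (Word x) \<longleftrightarrow> x \<noteq> [] \<and> hd x = i"
| "subprefix (Word z) (Empty i) \<longleftrightarrow> False"
| "subprefix (Word z) (Word x) \<longleftrightarrow> z \<noteq> [] \<and> prefix z x"

text \<open>
  The sectional curvature at \<open>\<mu>\<close> of the plane spanned by two distinct members \<open>X\<close>, \<open>Y\<close> of the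
  orthonormal family.  Members of the family are bounded, so all integrals exist; both series
  converge absolutely, by Bessel's inequality for \<open>X Y\<close>, \<open>X\<^sup>2\<close> and \<open>Y\<^sup>2\<close> in \<open>L\<^sup>2(\<mu>)\<close>.
\<close>

definition sectional_curvature ::
  "(bit \<Rightarrow> bit \<Rightarrow> real) \<Rightarrow> (bit \<Rightarrow> real) \<Rightarrow> (nat \<Rightarrow> bit) measure \<Rightarrow>
   ((nat \<Rightarrow> bit) \<Rightarrow> real) \<Rightarrow> ((nat \<Rightarrow> bit) \<Rightarrow> real) \<Rightarrow> real" where
  "sectional_curvature P \<pi> \<mu> X Y = 1 / 4 *
     ((\<Sum>\<^sub>\<infinity>Z\<in>basis_family P \<pi> \<mu>. (\<integral>\<omega>. X \<omega> * Y \<omega> * Z \<omega> \<partial>\<mu>)\<^sup>2)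
      - (\<Sum>\<^sub>\<infinity>Z\<in>basis_family P \<pi> \<mu>.
           (\<integral>\<omega>. (X \<omega>)\<^sup>2 * Z \<omega> \<partial>\<mu>) * (\<integral>\<omega>. (Y \<omega>)\<^sup>2 * Z \<omega> \<partial>\<mu>)))"

end

theory Submission
  imports Defs
begin

text \<open>
  The members of the family attached to words with first letter \<open>i\<close>, and the one attached to
  \<open>\<emptyset>\<^sup>i\<close>, all vanish off the event that the second letter of \<open>\<omega>\<close> is \<open>i\<close>.  Two members without a
  common subprefix therefore have disjoint supports, and no third member meets both of these:
  every term of the two series in the curvature vanishes.
\<close>

fun first_letter :: "index \<Rightarrow> bit" where
  "first_letter (Empty i) = i"
| "first_letter (Word x) = hd x"

lemma cylinder_Cons_second_letter:
  assumes "\<omega> \<in> cylinder (a # y)" "y \<noteq> []"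
  shows "\<omega> 1 = hd y"
  using assms by (cases y) (auto simp: cylinder_def)

text \<open>Each cylinder entering the definition prepends one free letter, which moves the first
  letter of the index to position 1.\<close>

lemma a_hat_eq_0:
  assumes "k \<in> indices" "\<omega> 1 \<noteq> first_letter k"
  shows "a_hat P \<pi> \<mu> k \<omega> = 0"
proof (cases k)
  case (Empty i)
  have "\<omega> \<notin> cylinder [a, i]" for a
    using cylinder_Cons_second_letter[of \<omega> a "[i]"] assms Empty by auto
  then show ?thesis
    using Empty by (cases i) (auto simp: normalized_def V1_def V2_def)
next
  case (Word x)
  then have "x \<noteq> []"
    using assms by (auto simp: indices_def)
  \<comment> \<open>With \<open>x\<close> nonempty, \<open>hd (x @ [b])\<close> is
    \<open>hd x\<close>; for an empty word, position 1 would hold \<open>b\<close> instead.\<close>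
  then have "\<omega> \<notin> cylinder (a # x @ [b])" for a b
    using cylinder_Cons_second_letter[of \<omega> a "x @ [b]"] assms Word by auto
  then show ?thesis
    using Word by (simp add: normalized_def a_fun_def e_fun_def)
qed

lemma a_hat_mult_eq_0:
  assumes "j \<in> indices" "k \<in> indices" "first_letter j \<noteq> first_letter k"
  shows "a_hat P \<pi> \<mu> j \<omega> * a_hat P \<pi> \<mu> k \<omega> = 0"
  using a_hat_eq_0[OF assms(1), of \<omega>] a_hat_eq_0[OF assms(2), of \<omega>] assms(3) by fastforce

text \<open>Turns equality of two first letters into a common subprefix: the same version of the
  empty word lies below both indices.\<close>

lemma Empty_first_letter_subprefix:
  "k \<in> indices \<Longrightarrow> subprefix (Empty (first_letter k)) k"
  by (cases k) (auto simp: indices_def)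

theorem proposition7p10:
  fixes r s :: real and P :: "bit \<Rightarrow> bit \<Rightarrow> real" and \<pi> :: "bit \<Rightarrow> real"
    and \<mu> :: "(nat \<Rightarrow> bit) measure" and x z :: index
  assumes "0 < r" "r < 1" "0 < s" "s < 1"
    and "P = transition r s"
    and "stationary_vector P \<pi>"
    and "markov_measure P \<pi> \<mu>"
    and "x \<in> indices" "z \<in> indices"
    and "\<not> (\<exists>w\<in>indices. subprefix w x \<and> subprefix w z)"
  shows "sectional_curvature P \<pi> \<mu> (a_hat P \<pi> \<mu> z) (a_hat P \<pi> \<mu> x) = 0"
proof -
  let ?a = "a_hat P \<pi> \<mu>"
  have ne: "first_letter z \<noteq> first_letter x"
    using assms(8-10) Empty_first_letter_subprefix[of x] Empty_first_letter_subprefix[of z]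
    by (auto simp: indices_def)
  have "(\<integral>\<omega>. ?a z \<omega> * ?a x \<omega> * Z \<omega> \<partial>\<mu>) = 0" for Z
    by (simp only: a_hat_mult_eq_0[OF assms(9,8) ne] mult_zero_left integral_zero)
  moreover have "(\<integral>\<omega>. (?a z \<omega>)\<^sup>2 * Z \<omega> \<partial>\<mu>) * (\<integral>\<omega>. (?a x \<omega>)\<^sup>2 * Z \<omega> \<partial>\<mu>) = 0"
    if Z: "Z \<in> basis_family P \<pi> \<mu>" for Z
  proof -
    obtain k where k: "k \<in> indices" "Z = ?a k"
      using Z unfolding basis_family_def by blast
    have vanish: "(\<integral>\<omega>. (?a j \<omega>)\<^sup>2 * Z \<omega> \<partial>\<mu>) = 0"
      if "j \<in> indices" "first_letter j \<noteq> first_letter k" for j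
      by (simp only: k(2) power2_eq_square mult.assoc a_hat_mult_eq_0[OF that(1) k(1) that(2)]
          mult_zero_right integral_zero)
    \<comment> \<open>\<open>first_letter k\<close> cannot equal both of two distinct letters, so at
      least one of the two factors vanishes.\<close>
    show ?thesis
      using vanish[OF assms(9)] vanish[OF assms(8)] ne by fastforce
  qed
  ultimately show ?thesis
    by (simp add: sectional_curvature_def infsum_0)
qed

end
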